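(* Let $\mathbf{X}_1,\dots,\mathbf{X}_N$ and $\mathbf{Y}_1,\dots,\mathbf{Y}_N$ be points in $\mathbb{R}^D$, let $\mu=\frac1N\sum_{i=1}^N\delta_{\mathbf{X}_i}$ and $\nu=\frac1N\sum_{i=1}^N\delta_{\mathbf{Y}_i}$, let $c(\cdot,\cdot)$ be a real-valued cost function, and let $C\in\mathbb{R}^{N\times N}$, $C_{ij}=c(\mathbf{X}_i,\mathbf{Y}_j)$. Let $\Pi_N$ be the set of doubly stochastic $N\times N$ matrices, $\exp(\Pi_N)$ its set of extreme points (the permutation matrices), $\mathcal{M}=\arg\min_{\pi\in\Pi_N}\langle C,\pi\rangle$, and $\pi^*=\arg\min_{\pi\in\mathcal{M}}\|\pi\|^2$. Assume that the matrix with all entries equal to $1/N$ does not belong to $\mathcal{M}$. For $\eta>0$ let $\gamma^\eta$ be the optimal coupling of the quadratically regularized problem (QOT), and let $\gamma^*$ be the minimum-norm solution of the optimal transport problem (OT) (see context). Then: (a) The coupling $\gamma^\eta$ is optimal for (OT) if and only if $$\eta\ge\eta^*:=2N\cdot\max_{\pi\in\exp(\Pi_N)\setminus\mathcal{M}}\frac{\langle\pi^*,\pi^*-\pi\rangle}{\langle C,\pi-\pi^*\rangle},$$ in which case $\gamma^\eta=\gamma^*$. (b) The slope of the suboptimality satisfies $$\limsup_{\eta\to\eta^*}\frac{\int c(x,y)\,d\gamma^\eta(x,y)-\int c(x,y)\,d\gamma^*(x,y)}{\eta^*-\eta}\le\frac12\left(\int c(x,y)^2\,d(\mu\otimes\nu)(x,y)-\left(\int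 c(x,y)\,d(\mu\otimes\nu)(x,y)\right)^2\right).$$
   Context: $\Gamma(\mu,\nu)$ denotes the set of couplings of $\mu$ and $\nu$, i.e. probability measures with marginals $\mu$ and $\nu$. (OT): $\inf_{\gamma\in\Gamma(\mu,\nu)}\int c(x,y)\,d\gamma(x,y)$. (QOT): $\inf_{\gamma\in\Gamma(\mu,\nu)}\int c(x,y)\,d\gamma(x,y)+\frac1\eta\left\|\frac{d\gamma}{d(\mu\otimes\nu)}\right\|^2_{L^2(\mu\otimes\nu)}$, where $d\gamma/d(\mu\otimes\nu)$ is the density of $\gamma$ with respect to the product measure $\mu\otimes\nu$; for each $\eta>0$ it has a unique minimizer $\gamma^\eta$. The minimum-norm solution $\gamma^*$ of (OT) is the unique coupling minimizing $\left\|\frac{d\gamma}{d(\mu\otimes\nu)}\right\|_{L^2(\mu\otimes\nu)}$ among all minimizers $\gamma$ of (OT). $\Pi_N=\{\pi\in\mathbb{R}^{N\times N}:\pi\mathbf{1}=\mathbf{1},\ \pi^\top\mathbf{1}=\mathbf{1},\ \pi_{ij}\ge0\}$, where $\mathbf{1}$ is the all-ones vector. $\langle A,B\rangle=\mathrm{Trace}(A^\top B)=\sum_{i,j}A_{ij}B_{ij}$ is the Frobenius inner product on $\mathbb{R}^{N\times N}$ and $\|\cdot\|$ the associated norm. A doubly stochastic matrix $\pi$ corresponds to the coupling $\frac1N\sum_{i,j}\pi_{ij}\delta_{(\mathbf{X}_i,\mathbf{Y}_j)}$. *)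

theory Defs
  imports "HOL-Analysis.Analysis" "HOL-Probability.Probability_Measure"
begin

definition minimizers :: "('a \<Rightarrow> 'b::linorder) \<Rightarrow> 'a set \<Rightarrow> 'a set" where
  "minimizers f S = {x. is_arg_min f (\<lambda>x. x \<in> S) x}"

definition the_minimizer :: "('a \<Rightarrow> 'b::linorder) \<Rightarrow> 'a set \<Rightarrow> 'a" where
  "the_minimizer f S = (THE x. x \<in> minimizers f S)"


definition couplings :: "'a measure \<Rightarrow> 'b measure \<Rightarrow> ('a \<times> 'b) measure set" where
  "couplings \<mu> \<nu> =
     {\<gamma>. prob_space \<gamma> \<and> sets \<gamma> = sets (\<mu> \<Otimes>\<^sub>M \<nu>) \<and> distr \<gamma> \<mu> fst = \<mu> \<and> distr \<gamma> \<nu> snd = \<nu>}"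

(* Integrals are taken with respect to the completion. For Borel functions this changes nothing
   (integral_completion), but it lets the cost function be arbitrary: if the marginals are
   finitely supported, every function is measurable with respect to the completed coupling,
   whereas the library integral of a non-Borel function against the Borel measure is 0. *)
definition cint :: "('a \<times> 'b) measure \<Rightarrow> ('a \<Rightarrow> 'b \<Rightarrow> real) \<Rightarrow> real" where
  "cint \<gamma> c = (\<integral>(x, y). c x y \<partial>completion \<gamma>)"

(* The norm of the density of \<gamma> in L2 of the product measure, with the usual value \<infinity> if \<gamma> has
   no density or the density is not square integrable. *)
definition density_norm :: "'a measure \<Rightarrow> 'b measure \<Rightarrow> ('a \<times> 'b) measure \<Rightarrow> ereal" where
  "density_norm \<mu> \<nu> \<gamma> =
     (let I = \<integral>\<^sup>+ z. (RN_deriv (\<mu> \<Otimes>\<^sub>M \<nu>) \<gamma> z)\<^sup>2 \<partial>(\<mu> \<Otimes>\<^sub>M \<nu>)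
      in if absolutely_continuous (\<mu> \<Otimes>\<^sub>M \<nu>) \<gamma> \<and> I < \<infinity>
         then ereal (sqrt (enn2real I)) else \<infinity>)"

definition ot_minimizers ::
    "('a \<Rightarrow> 'b \<Rightarrow> real) \<Rightarrow> 'a measure \<Rightarrow> 'b measure \<Rightarrow> ('a \<times> 'b) measure set" where
  "ot_minimizers c \<mu> \<nu> = minimizers (\<lambda>\<gamma>. cint \<gamma> c) (couplings \<mu> \<nu>)"

definition ot_min_norm ::
    "('a \<Rightarrow> 'b \<Rightarrow> real) \<Rightarrow> 'a measure \<Rightarrow> 'b measure \<Rightarrow> ('a \<times> 'b) measure" where
  "ot_min_norm c \<mu> \<nu> = the_minimizer (density_norm \<mu> \<nu>) (ot_minimizers c \<mu> \<nu>)"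

definition qot_optimal ::
    "('a \<Rightarrow> 'b \<Rightarrow> real) \<Rightarrow> 'a measure \<Rightarrow> 'b measure \<Rightarrow> real \<Rightarrow> ('a \<times> 'b) measure" where
  "qot_optimal c \<mu> \<nu> \<eta> =
     the_minimizer (\<lambda>\<gamma>. ereal (cint \<gamma> c) + ereal (1 / \<eta>) * (density_norm \<mu> \<nu> \<gamma>)\<^sup>2)
       (couplings \<mu> \<nu>)"


definition empirical :: "('n::finite \<Rightarrow> 'a::topological_space) \<Rightarrow> 'a measure" where
  "empirical X = distr (uniform_count_measure UNIV) borel X"

lemma emeasure_empirical:
  assumes "A \<in> sets borel"
  shows "emeasure (empirical (X :: 'n::finite \<Rightarrow> 'a::topological_space)) A
    = ennreal (1 / real CARD('n) * (\<Sum>i\<in>UNIV. indicator A (X i)))"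
proof -
  have m: "X \<in> uniform_count_measure UNIV \<rightarrow>\<^sub>M borel"
    by (simp add: measurable_def space_uniform_count_measure sets_uniform_count_measure)
  have "emeasure (empirical X) A = emeasure (uniform_count_measure UNIV) (X -` A)"
    by (simp add: empirical_def emeasure_distr[OF m assms] space_uniform_count_measure)
  also have "\<dots> = ennreal (real (card (X -` A)) / real CARD('n))"
    by (simp add: emeasure_uniform_count_measure)
  also have "real (card (X -` A)) = (\<Sum>i\<in>UNIV. indicator A (X i))"
    by (simp add: indicator_def vimage_def)
  finally show ?thesis by simp
qed

definition doubly_stochastic :: "(real^'n^'n) set" where
  "doubly_stochastic = {\<pi>. \<pi> *v 1 = 1 \<and> transpose \<pi> *v 1 = 1 \<and> (\<forall>i j. \<pi> $ i $ j \<ge> 0)}"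

(* The library inner product on real^'n^'n, and hence its norm, is the Frobenius one. *)
lemma inner_frobenius:
  "(A :: real^'n^'n) \<bullet> B = (\<Sum>i\<in>UNIV. \<Sum>j\<in>UNIV. A $ i $ j * B $ i $ j)"
  by (simp add: inner_vec_def)

end

theory Submission
  imports Defs
begin

text \<open>Let \<open>s = \<eta> / (2 N)\<close>. Completing the square, a doubly stochastic \<open>\<pi>\<close> minimizes
  \<open>\<langle>C, \<pi>\<rangle> / N + \<parallel>\<pi>\<parallel>\<^sup>2 / \<eta>\<close> iff it is the projection of \<open>- s C\<close> onto the polytope of doubly stochastic
  matrices. If this projection lies in the optimal face \<open>M\<close>, it is the point \<open>\<pi>\<^sup>*\<close> of \<open>M\<close> closest to
  the origin, and the variational inequality of the projection at \<open>\<pi>\<^sup>*\<close>, which has to be tested on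
  extreme points only, says exactly \<open>\<eta> \<ge> \<eta>\<^sup>*\<close>. The slope bound is the Lipschitz continuity of the
  projection, applied to the cost with its mean subtracted: this changes the inner products with
  doubly stochastic matrices by a constant only, and turns \<open>\<parallel>C\<parallel>\<^sup>2\<close> into the variance.

  The sample points may coincide. A coupling then determines only the averages of a matrix over the
  blocks of equal points; averaging preserves the cost and does not increase the norm, so the
  minimizing matrices are block-constant and nothing is lost.\<close>

section \<open>Projections onto a polytope\<close>

lemma minimizers_iff: "x \<in> minimizers f S \<longleftrightarrow> x \<in> S \<and> (\<forall>y\<in>S. f x \<le> f y)"
  by (auto simp: minimizers_def is_arg_min_def not_less)

lemma the_minimizer_eqI:
  assumes "x \<in> S" and "\<And>y. y \<in> S \<Longrightarrow> y \<noteq> x \<Longrightarrow> f x < f y"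
  shows "the_minimizer f S = x"
  unfolding the_minimizer_def
proof (rule the_equality)
  show "x \<in> minimizers f S"
    unfolding minimizers_iff using assms by (metis order.refl order.strict_implies_order)
  show "y = x" if "y \<in> minimizers f S" for y
    using that assms unfolding minimizers_iff by (metis leD)
qed

text \<open>For the backward direction, the squared distance from \<open>x\<close> to
  \<open>y\<close> is expanded around \<open>p\<close>. Beyond the squared distance from
  \<open>x\<close> to \<open>p\<close> it contains two terms, nonnegative by the inequality and as a
  square.\<close>

lemma closest_point_eq_iff:
  fixes K :: "'a::euclidean_space set"
  assumes "convex K" "closed K" "p \<in> K"
  shows "closest_point K x = p \<longleftrightarrow> (\<forall>y\<in>K. (x - p) \<bullet> (y - p) \<le> 0)"
proof
  assume "closest_point K x = p"
  then show "\<forall>y\<in>K. (x - p) \<bullet> (y - p) \<le> 0"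
    using closest_point_dot[OF assms(1,2)] by blast
next
  assume vi: "\<forall>y\<in>K. (x - p) \<bullet> (y - p) \<le> 0"
  have "dist x p \<le> dist x y" if "y \<in> K" for y
  proof -
    have "(norm (x - y))\<^sup>2 = (norm (x - p))\<^sup>2 - 2 * ((x - p) \<bullet> (y - p)) + (norm (y - p))\<^sup>2"
      by (simp add: power2_norm_eq_inner inner_commute algebra_simps)
    then have "(norm (x - p))\<^sup>2 \<le> (norm (x - y))\<^sup>2"
      using vi that by (smt (verit) zero_le_power2)
    then show ?thesis
      by (simp add: dist_norm)
  qed
  then show "closest_point K x = p"
    using closest_point_unique[OF assms] by simp
qed

lemma closest_point_0_less:
  fixes K :: "'a::euclidean_space set"
  assumes "convex K" "closed K" "y \<in> K" "y \<noteq> closest_point K 0"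
  shows "norm (closest_point K 0) < norm y"
  using closest_point_lt[OF assms] by simp

text \<open>The quadratic objective is the squared distance to \<open>- s *\<^sub>R a\<close> up to
  the constant \<open>(norm (s *\<^sub>R a))\<^sup>2\<close>; strictness is uniqueness of the
  nearest point.\<close>

lemma closest_point_quadratic_less:
  fixes K :: "'a::euclidean_space set"
  assumes "convex K" "closed K" "y \<in> K" "y \<noteq> closest_point K (- s *\<^sub>R a)"
  shows "2 * s * (a \<bullet> closest_point K (- s *\<^sub>R a)) + (norm (closest_point K (- s *\<^sub>R a)))\<^sup>2
    < 2 * s * (a \<bullet> y) + (norm y)\<^sup>2"
proof -
  have *: "(dist (- s *\<^sub>R a) z)\<^sup>2 = 2 * s * (a \<bullet> z) + (norm z)\<^sup>2 + (norm (s *\<^sub>R a))\<^sup>2" for z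
    unfolding dist_norm power2_norm_eq_inner by (simp add: inner_commute algebra_simps)
  have "(dist (- s *\<^sub>R a) (closest_point K (- s *\<^sub>R a)))\<^sup>2 < (dist (- s *\<^sub>R a) y)\<^sup>2"
    using closest_point_lt[OF assms] by (simp add: power_strict_mono)
  then show ?thesis
    unfolding * by simp
qed

text \<open>By Krein-Milman \<open>K\<close> is the hull of its extreme points, and a half-space
  containing these is convex.\<close>

lemma inner_le_on_hull_extreme_points:
  fixes K :: "'a::euclidean_space set"
  assumes "compact K" "convex K" and "\<And>e. e extreme_point_of K \<Longrightarrow> a \<bullet> e \<le> b" and "x \<in> K"
  shows "a \<bullet> x \<le> b"
proof -
  have "K = convex hull {e. e extreme_point_of K}"
    using Krein_Milman_Minkowski assms by blast
  also have "\<dots> \<subseteq> {z. a \<bullet> z \<le> b}"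
    using assms(3) by (intro hull_minimal convex_halfspace_le) auto
  finally show ?thesis
    using assms(4) by auto
qed

text \<open>The minimum is attained by compactness, so the minimizers are \<open>K\<close> cut by
  one closed half-space.\<close>

lemma minimizers_inner:
  fixes K :: "'a::euclidean_space set"
  assumes "compact K" "convex K" "K \<noteq> {}"
  shows "convex (minimizers (\<lambda>x. a \<bullet> x) K)" and "closed (minimizers (\<lambda>x. a \<bullet> x) K)"
    and "minimizers (\<lambda>x. a \<bullet> x) K \<noteq> {}"
proof -
  obtain p where p: "p \<in> K" "\<forall>y\<in>K. a \<bullet> p \<le> a \<bullet> y"
    using continuous_attains_inf[OF assms(1,3), of "\<lambda>x. a \<bullet> x"]
      continuous_on_inner[OF continuous_on_const continuous_on_id] by blast
  then have eq: "minimizers (\<lambda>x. a \<bullet> x) K = K \<inter> {x. a \<bullet> x \<le> a \<bullet> p}"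
    unfolding set_eq_iff minimizers_iff by (metis (mono_tags) Int_iff mem_Collect_eq order_trans)
  show "convex (minimizers (\<lambda>x. a \<bullet> x) K)"
    unfolding eq using assms by (intro convex_Int convex_halfspace_le)
  show "closed (minimizers (\<lambda>x. a \<bullet> x) K)"
    unfolding eq using assms by (intro closed_Int closed_halfspace_le compact_imp_closed)
  show "minimizers (\<lambda>x. a \<bullet> x) K \<noteq> {}"
    unfolding eq using p by auto
qed

text \<open>The projection of \<open>- s *\<^sub>R a\<close> is \<open>p\<close> exactly when the
  variational inequality at \<open>p\<close> holds at every extreme point. Each extreme point off
  the face \<open>F\<close> bounds \<open>s\<close> from below by one quotient, and \<open>t\<close>
  is the largest of these bounds.\<close>

lemma
  fixes K :: "'a::euclidean_space set"
  assumes K: "polytope K" "K \<noteq> {}"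
    and F: "F = minimizers (\<lambda>x. a \<bullet> x) K"
    and p: "p = closest_point F 0"
    and t: "t = (MAX e\<in>{e. e extreme_point_of K} - F. (p \<bullet> (p - e)) / (a \<bullet> (e - p)))"
    and not_face: "closest_point K 0 \<notin> F"
  shows threshold_pos: "0 < t"
    and closest_point_in_face_iff: "closest_point K (- s *\<^sub>R a) \<in> F \<longleftrightarrow> t \<le> s"
    and closest_point_in_face_eq: "t \<le> s \<Longrightarrow> closest_point K (- s *\<^sub>R a) = p"
proof -
  let ?E = "{e. e extreme_point_of K} - F"
  let ?q = "\<lambda>e. (p \<bullet> (p - e)) / (a \<bullet> (e - p))"
  note cK = polytope_imp_compact[OF K(1)] polytope_imp_convex[OF K(1)]
  note clK = compact_imp_closed[OF cK(1)]
  note Fc = minimizers_inner[OF cK K(2), of a, folded F]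
  have pF: "p \<in> F"
    unfolding p using Fc by (simp add: closest_point_in_set)
  then have pK: "p \<in> K"
    unfolding F minimizers_iff by simp
  have p_vi: "0 \<le> p \<bullet> (y - p)" if "y \<in> F" for y
    using closest_point_dot[OF Fc(1,2) that, of 0] unfolding p by simp
  have E_pos: "0 < a \<bullet> (e - p)" if "e \<in> ?E" for e
  proof -
    have "e \<in> K" "\<not> (\<forall>y\<in>K. a \<bullet> e \<le> a \<bullet> y)"
      using that by (auto simp: F minimizers_iff extreme_point_of_def)
    moreover have "a \<bullet> p \<le> a \<bullet> y" if "y \<in> K" for y
      using pF that unfolding F minimizers_iff by blast
    ultimately show ?thesis
      by (force simp: inner_diff_right)
  qed
  have F_eq: "a \<bullet> y = a \<bullet> p" if "y \<in> F" for y
    using that pF unfolding F minimizers_iff by (meson antisym)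
  have fin: "finite ?E"
    using finite_polyhedron_extreme_points[of K] K(1) by (simp add: polytope_imp_polyhedron)
  \<comment> \<open>\<open>Max\<close> is informative only on a nonempty set. If all extreme points
    were in \<open>F\<close>, the functional would nowhere exceed its minimum, and \<open>F\<close>
    would contain the projection of the origin.\<close>
  have ne: "?E \<noteq> {}"
  proof
    assume "?E = {}"
    then have "a \<bullet> e \<le> a \<bullet> p" if "e extreme_point_of K" for e
      using F_eq[of e] that by auto
    then have "a \<bullet> x \<le> a \<bullet> p" if "x \<in> K" for x
      using inner_le_on_hull_extreme_points[OF cK _ that] by blast
    then have "closest_point K 0 \<in> F"
      using closest_point_in_set[OF clK K(2), of 0] pF unfolding F minimizers_iff
      by (meson order_trans)
    then show False
      using not_face by simp
  qed
  \<comment> \<open>The denominators are positive by \<open>E_pos\<close>, so the bound on the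
    maximum becomes one linear inequality per extreme point off \<open>F\<close>.\<close>
  have t_le: "t \<le> s \<longleftrightarrow> (\<forall>e\<in>?E. p \<bullet> (p - e) \<le> s * (a \<bullet> (e - p)))" for s
    unfolding t using fin ne by (subst Max_le_iff) (auto simp: pos_divide_le_eq E_pos)
  \<comment> \<open>The variational inequality is affine in \<open>y\<close>, so extreme points
    suffice. On \<open>F\<close> the cost term cancels and the minimality of \<open>p\<close>
    remains; off \<open>F\<close> the inequality is \<open>t_le\<close>.\<close>
  have opt: "closest_point K (- s *\<^sub>R a) = p" if "t \<le> s" for s
    unfolding closest_point_eq_iff[OF cK(2) clK pK]
  proof
    fix y
    assume "y \<in> K"
    have "(- s *\<^sub>R a - p) \<bullet> y \<le> (- s *\<^sub>R a - p) \<bullet> p"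
    proof (rule inner_le_on_hull_extreme_points[OF cK _ \<open>y \<in> K\<close>])
      fix e
      assume e: "e extreme_point_of K"
      show "(- s *\<^sub>R a - p) \<bullet> e \<le> (- s *\<^sub>R a - p) \<bullet> p"
      proof (cases "e \<in> F")
        case True
        then show ?thesis
          using p_vi[OF True] F_eq[OF True] by (simp add: algebra_simps)
      next
        case False
        then have "p \<bullet> (p - e) \<le> s * (a \<bullet> (e - p))"
          using that e unfolding t_le by blast
        then show ?thesis
          by (simp add: algebra_simps)
      qed
    qed
    then show "(- s *\<^sub>R a - p) \<bullet> (y - p) \<le> 0"
      by (simp add: inner_diff_right)
  qed
  show "t \<le> s \<Longrightarrow> closest_point K (- s *\<^sub>R a) = p"
    by (rule opt)
  have conv: "t \<le> s" if q: "closest_point K (- s *\<^sub>R a) \<in> F" for s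
  proof -
    define q where "q = closest_point K (- s *\<^sub>R a)"
    have q_vi: "(- s *\<^sub>R a - q) \<bullet> (y - q) \<le> 0" if "y \<in> K" for y
      unfolding q_def by (rule closest_point_dot[OF cK(2) clK that])
    have "q \<in> F"
      using q q_def by simp
    \<comment> \<open>The cost is constant on \<open>F\<close>, so the term with \<open>s\<close>
      vanishes there: \<open>q\<close> satisfies the inequality that characterizes the projection of
      the origin onto \<open>F\<close>, which is \<open>p\<close>.\<close>
    have "(0 - q) \<bullet> (y - q) \<le> 0" if "y \<in> F" for y
      using q_vi[of y] F_eq[OF that] F_eq[OF \<open>q \<in> F\<close>] that
      by (simp add: F minimizers_iff algebra_simps)
    then have "q = p"
      unfolding p using closest_point_eq_iff[OF Fc(1,2) \<open>q \<in> F\<close>, of 0] by simp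
    then show ?thesis
      unfolding t_le using q_vi by (fastforce simp: extreme_point_of_def algebra_simps)
  qed
  show "closest_point K (- s *\<^sub>R a) \<in> F \<longleftrightarrow> t \<le> s"
    using opt conv pF by auto
  \<comment> \<open>At \<open>s = 0\<close> the projected point is the origin, whose projection is
    outside \<open>F\<close> by \<open>not_face\<close>.\<close>
  show "0 < t"
    using conv[of 0] opt[of 0] not_face pF by (metis not_less scaleR_zero_left neg_0_equal_iff_equal scale_minus_left)
qed

text \<open>\<open>b\<close> is any representative of the linear functional \<open>a\<close> on the directions of \<open>K\<close>; the
  centred cost is the one that produces the variance.\<close>

lemma closest_point_slope_le:
  fixes K :: "'a::euclidean_space set"
  assumes K: "convex K" "closed K" "K \<noteq> {}"
    and b: "\<And>y z. y \<in> K \<Longrightarrow> z \<in> K \<Longrightarrow> a \<bullet> (y - z) = b \<bullet> (y - z)"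
    and "s \<le> t"
  shows "a \<bullet> (closest_point K (- s *\<^sub>R a) - closest_point K (- t *\<^sub>R a)) \<le> (t - s) * (norm b)\<^sup>2"
proof -
  define p where "p = closest_point K (- s *\<^sub>R a)"
  define q where "q = closest_point K (- t *\<^sub>R a)"
  define d where "d = p - q"
  have pq: "p \<in> K" "q \<in> K"
    unfolding p_def q_def using K by (auto simp: closest_point_in_set)
  have ab: "a \<bullet> d = b \<bullet> d"
    unfolding d_def using b pq by blast
  \<comment> \<open>The variational inequalities of \<open>p\<close> and \<open>q\<close> are tested
    at each other's point; their sum bounds \<open>(norm d)\<^sup>2\<close> by a multiple of
    \<open>b \<bullet> d\<close>. Cauchy-Schwarz is then used twice: first to bound
    \<open>norm d\<close>, then to return to \<open>b \<bullet> d\<close>.\<close>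
  have "(- s *\<^sub>R a - p) \<bullet> (q - p) \<le> 0" "(- t *\<^sub>R a - q) \<bullet> (p - q) \<le> 0"
    unfolding p_def q_def using pq[unfolded p_def q_def] closest_point_dot[OF K(1,2)] by blast+
  then have "(norm d)\<^sup>2 \<le> (t - s) * (b \<bullet> d)"
    unfolding ab[symmetric] unfolding d_def power2_norm_eq_inner
    by (simp add: algebra_simps inner_commute)
  also have "\<dots> \<le> (t - s) * (norm b * norm d)"
    using \<open>s \<le> t\<close> by (intro mult_left_mono norm_cauchy_schwarz) auto
  finally have "norm d * norm d \<le> ((t - s) * norm b) * norm d"
    by (simp add: power2_eq_square mult_ac)
  then have "norm d \<le> (t - s) * norm b"
    using \<open>s \<le> t\<close> by (cases "norm d = 0") (auto simp: mult_le_cancel_right)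
  then have "norm b * norm d \<le> norm b * ((t - s) * norm b)"
    by (rule mult_left_mono) simp
  then have "b \<bullet> d \<le> (t - s) * (norm b)\<^sup>2"
    using norm_cauchy_schwarz[of b d] by (simp add: power2_eq_square mult_ac)
  then show ?thesis
    using ab by (simp add: d_def p_def q_def)
qed

section \<open>The polytope of doubly stochastic matrices\<close>

lemma doubly_stochastic_iff:
  "\<pi> \<in> doubly_stochastic \<longleftrightarrow> (\<forall>i. (\<Sum>j\<in>UNIV. \<pi> $ i $ j) = 1) \<and> (\<forall>j. (\<Sum>i\<in>UNIV. \<pi> $ i $ j) = 1)
    \<and> (\<forall>i j. 0 \<le> \<pi> $ i $ j)"
  by (simp add: doubly_stochastic_def vec_eq_iff matrix_vector_mult_def transpose_def)

lemma polytope_doubly_stochastic: "polytope (doubly_stochastic :: (real^'n^'n) set)"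
proof -
  \<comment> \<open>The normals are the matrices with ones in a single row, a single column or a
    single entry, so that row sums, column sums and entries become inner products.\<close>
  let ?R = "\<lambda>i. {\<pi> :: real^'n^'n. (\<chi> k j. if k = i then 1 else 0) \<bullet> \<pi> = 1}"
  let ?C = "\<lambda>j. {\<pi> :: real^'n^'n. (\<chi> i k. if k = j then 1 else 0) \<bullet> \<pi> = 1}"
  let ?P = "\<lambda>(i, j). {\<pi> :: real^'n^'n. axis i (axis j 1) \<bullet> \<pi> \<ge> 0}"
  have row: "(\<chi> k j. if k = i then 1 else 0) \<bullet> \<pi> = (\<Sum>j\<in>UNIV. \<pi> $ i $ j)"
    for i and \<pi> :: "real^'n^'n"
    by (subst inner_frobenius, subst sum.swap) (simp add: if_distrib[of "\<lambda>x. x * _"] cong: if_cong)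
  have col: "(\<chi> i k. if k = j then 1 else 0) \<bullet> \<pi> = (\<Sum>i\<in>UNIV. \<pi> $ i $ j)"
    for j and \<pi> :: "real^'n^'n"
    by (simp add: inner_frobenius if_distrib[of "\<lambda>x. x * _"] cong: if_cong)
  have eq: "doubly_stochastic = \<Inter> (range ?R) \<inter> \<Inter> (range ?C) \<inter> \<Inter> (range ?P)"
    unfolding set_eq_iff doubly_stochastic_iff by (auto simp: row col inner_axis')
  have "polyhedron (doubly_stochastic :: (real^'n^'n) set)"
    unfolding eq
    by (intro polyhedron_Int polyhedron_Inter)
      (auto intro: polyhedron_hyperplane polyhedron_halfspace_ge)
  moreover have "bounded (doubly_stochastic :: (real^'n^'n) set)"
  proof (rule boundedI)
    fix \<pi> :: "real^'n^'n"
    assume \<pi>: "\<pi> \<in> doubly_stochastic"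
    have "norm \<pi> \<le> (\<Sum>i\<in>UNIV. norm (\<pi> $ i))"
      by (simp add: norm_vec_def L2_set_le_sum)
    also have "\<dots> \<le> (\<Sum>i\<in>UNIV. \<Sum>j\<in>UNIV. \<bar>\<pi> $ i $ j\<bar>)"
      by (intro sum_mono norm_le_l1_cart)
    also have "\<dots> = real CARD('n)"
      using \<pi> by (simp add: doubly_stochastic_iff)
    finally show "norm \<pi> \<le> real CARD('n)" .
  qed
  ultimately show ?thesis
    by (simp add: polytope_eq_bounded_polyhedron)
qed

section \<open>Finitely supported measures\<close>

text \<open>Here \<open>f\<close> is arbitrary: it agrees almost everywhere with a finite sum of
  multiples of indicators of measurable singletons.\<close>

lemma nn_integral_finite_support:
  assumes S: "finite S" "\<And>s. s \<in> S \<Longrightarrow> {s} \<in> sets M" and ae: "AE z in M. z \<in> S"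
  shows "(\<integral>\<^sup>+ z. f z \<partial>M) = (\<Sum>s\<in>S. f s * emeasure M {s})"
proof -
  have "(\<integral>\<^sup>+ z. f z \<partial>M) = (\<integral>\<^sup>+ z. (\<Sum>s\<in>S. f s * indicator {s} z) \<partial>M)"
  proof (rule nn_integral_cong_AE)
    show "AE z in M. f z = (\<Sum>s\<in>S. f s * indicator {s} z)"
      using ae by eventually_elim (simp add: S(1) indicator_def if_distrib[of "\<lambda>x. _ * x"] cong: if_cong)
  qed
  also have "\<dots> = (\<Sum>s\<in>S. f s * emeasure M {s})"
    using S by (subst nn_integral_sum) (auto simp: nn_integral_cmult_indicator)
  finally show ?thesis .
qed

lemma emeasure_finite_support:
  assumes "finite S" "\<And>s. s \<in> S \<Longrightarrow> {s} \<in> sets M" "AE z in M. z \<in> S" and "A \<in> sets M"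
  shows "emeasure M A = (\<Sum>s\<in>S. indicator A s * emeasure M {s})"
  using nn_integral_finite_support[OF assms(1-3), of "indicator A"] assms(4) by simp

lemma integral_completion_finite_support:
  fixes f :: "'a \<Rightarrow> real"
  assumes M: "finite_measure M" and S: "finite S" "\<And>s. s \<in> S \<Longrightarrow> {s} \<in> sets M"
    and ae: "AE z in M. z \<in> S"
  shows "(\<integral>z. f z \<partial>completion M) = (\<Sum>s\<in>S. f s * measure M {s})"
proof -
  interpret finite_measure M by fact
  define g where "g z = (\<Sum>s\<in>S. f s * indicator {s} z)" for z
  have g: "g \<in> borel_measurable M"
    unfolding g_def using S by (intro borel_measurable_sum) simp
  have fg: "AE z in M. f z = g z"
    using ae unfolding g_def
    by eventually_elim (simp add: S(1) indicator_def if_distrib[of "\<lambda>x. _ * x"] cong: if_cong)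
  have f: "f \<in> borel_measurable (completion M)"
  proof (rule measurableI)
    fix B :: "real set"
    assume "B \<in> sets borel"
    then have gB: "g -` B \<inter> space M \<in> sets (completion M)"
      using measurable_sets[OF g] by (auto intro: sets_completionI_sets)
    \<comment> \<open>The preimages under \<open>f\<close> and under the measurable \<open>g\<close>
      differ by a null set, and the completion contains all such modifications.\<close>
    have "AE z in completion M. z \<in> g -` B \<inter> space M \<longleftrightarrow> z \<in> f -` B \<inter> space (completion M)"
      using AE_completion[OF fg] by eventually_elim simp
    then show "f -` B \<inter> space (completion M) \<in> sets (completion M)"
      by (rule completion.in_sets_AE[OF _ gB]) auto
  qed simp
  have "(\<integral>z. f z \<partial>completion M) = (\<integral>z. g z \<partial>completion M)"
    by (rule integral_cong_AE[OF f measurable_completion[OF g] AE_completion[OF fg]])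
  also have "\<dots> = (\<integral>z. g z \<partial>M)"
    by (rule integral_completion[OF g])
  also have "\<dots> = (\<Sum>s\<in>S. f s * measure M {s})"
    unfolding g_def using S by (subst Bochner_Integration.integral_sum) (auto simp: less_top[symmetric])
  finally show ?thesis .
qed

text \<open>Both measures live on the atoms in \<open>S\<close>, all of positive finite
  \<open>M\<close>-mass, so the quotient of the atoms is a density. It serves to identify
  \<open>RN_deriv\<close>.\<close>

lemma density_finite_support:
  assumes sets: "sets N = sets M"
    and S: "finite S" "\<And>s. s \<in> S \<Longrightarrow> {s} \<in> sets M"
    and ae: "AE z in M. z \<in> S" "AE z in N. z \<in> S"
    and fin: "\<And>s. s \<in> S \<Longrightarrow> emeasure M {s} \<noteq> 0" "\<And>s. s \<in> S \<Longrightarrow> emeasure M {s} \<noteq> \<infinity>"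
  shows "N = density M (\<lambda>z. \<Sum>s\<in>S. emeasure N {s} / emeasure M {s} * indicator {s} z)"
    (is "N = density M ?g")
proof (rule measure_eqI)
  show "sets N = sets (density M ?g)"
    using sets by simp
  fix A
  assume A: "A \<in> sets N"
  have g: "?g \<in> borel_measurable M"
    using S by (intro borel_measurable_sum) simp
  have "emeasure (density M ?g) A = (\<Sum>s\<in>S. ?g s * indicator A s * emeasure M {s})"
    using A sets nn_integral_finite_support[OF S ae(1)] by (subst emeasure_density[OF g]) auto
  also have "\<dots> = (\<Sum>s\<in>S. indicator A s * emeasure N {s})"
  proof (rule sum.cong)
    fix s
    assume s: "s \<in> S"
    then have "?g s = emeasure N {s} / emeasure M {s}"
      by (simp add: S(1) indicator_def if_distrib[of "\<lambda>x. _ * x"] cong: if_cong)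
    then have "?g s * emeasure M {s} = emeasure N {s}"
      using fin[OF s] by (simp only: ennreal_divide_times) (simp add: less_top)
    then show "?g s * indicator A s * emeasure M {s} = indicator A s * emeasure N {s}"
      by (simp only: mult.commute[of _ "indicator A s"] mult.assoc)
  qed simp
  also have "\<dots> = emeasure N A"
    using emeasure_finite_support[OF S(1) _ ae(2) A] S(2) sets by simp
  finally show "emeasure N A = emeasure (density M ?g) A" ..
qed

lemma density_norm_finite_support:
  fixes \<mu> :: "'a measure" and \<nu> :: "'b measure" and \<gamma> :: "('a \<times> 'b) measure"
  defines "\<rho> \<equiv> \<mu> \<Otimes>\<^sub>M \<nu>"
  assumes \<rho>: "prob_space \<rho>" and \<gamma>: "prob_space \<gamma>" "sets \<gamma> = sets \<rho>"
    and S: "finite S" "\<And>s. s \<in> S \<Longrightarrow> {s} \<in> sets \<rho>"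
    and ae: "AE z in \<rho>. z \<in> S" "AE z in \<gamma>. z \<in> S"
    and pos: "\<And>s. s \<in> S \<Longrightarrow> 0 < measure \<rho> {s}"
  shows "density_norm \<mu> \<nu> \<gamma> = ereal (sqrt (\<Sum>s\<in>S. (measure \<gamma> {s})\<^sup>2 / measure \<rho> {s}))"
proof -
  interpret \<rho>: prob_space \<rho> by fact
  interpret \<gamma>: prob_space \<gamma> by fact
  let ?g = "\<lambda>z. \<Sum>s\<in>S. emeasure \<gamma> {s} / emeasure \<rho> {s} * indicator {s} z"
  have dens: "\<gamma> = density \<rho> ?g"
    by (rule density_finite_support[OF \<gamma>(2) S ae])
      (simp_all add: \<rho>.emeasure_eq_measure order.strict_implies_not_eq[OF pos, symmetric])
  have g: "?g \<in> borel_measurable \<rho>"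
    using S by (intro borel_measurable_sum) simp
  have ac: "absolutely_continuous \<rho> \<gamma>"
    by (subst dens, rule absolutely_continuousI_density[OF g])
  \<comment> \<open>\<open>RN_deriv\<close> is determined only up to null sets, which the integral
    of its square ignores.\<close>
  have "AE z in \<rho>. ?g z = RN_deriv \<rho> \<gamma> z"
    by (rule \<rho>.RN_deriv_unique[OF g dens[symmetric]])
  then have "(\<integral>\<^sup>+ z. (RN_deriv \<rho> \<gamma> z)\<^sup>2 \<partial>\<rho>) = (\<integral>\<^sup>+ z. (?g z)\<^sup>2 \<partial>\<rho>)"
    by (intro nn_integral_cong_AE) auto
  also have "\<dots> = (\<Sum>s\<in>S. (?g s)\<^sup>2 * emeasure \<rho> {s})"
    by (rule nn_integral_finite_support[OF S ae(1)])
  also have "\<dots> = (\<Sum>s\<in>S. ennreal ((measure \<gamma> {s})\<^sup>2 / measure \<rho> {s}))"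
  proof (rule sum.cong)
    fix s
    assume s: "s \<in> S"
    then have "?g s = emeasure \<gamma> {s} / emeasure \<rho> {s}"
      by (simp add: S(1) indicator_def if_distrib[of "\<lambda>x. _ * x"] cong: if_cong)
    also have "\<dots> = ennreal (measure \<gamma> {s} / measure \<rho> {s})"
      using pos[OF s] by (simp add: \<rho>.emeasure_eq_measure \<gamma>.emeasure_eq_measure divide_ennreal)
    finally have "(?g s)\<^sup>2 * emeasure \<rho> {s}
        = ennreal ((measure \<gamma> {s} / measure \<rho> {s})\<^sup>2 * measure \<rho> {s})"
      by (simp add: \<rho>.emeasure_eq_measure ennreal_power ennreal_mult)
    also have "(measure \<gamma> {s} / measure \<rho> {s})\<^sup>2 * measure \<rho> {s} = (measure \<gamma> {s})\<^sup>2 / measure \<rho> {s}"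
      using pos[OF s] by (simp add: power2_eq_square)
    finally show "(?g s)\<^sup>2 * emeasure \<rho> {s} = ennreal ((measure \<gamma> {s})\<^sup>2 / measure \<rho> {s})" .
  qed simp
  also have "\<dots> = ennreal (\<Sum>s\<in>S. (measure \<gamma> {s})\<^sup>2 / measure \<rho> {s})"
    by (simp add: sum_ennreal)
  finally have I: "(\<integral>\<^sup>+ z. (RN_deriv \<rho> \<gamma> z)\<^sup>2 \<partial>\<rho>) = ennreal (\<Sum>s\<in>S. (measure \<gamma> {s})\<^sup>2 / measure \<rho> {s})" .
  \<comment> \<open>Absolute continuity and the finite value of the integral rule out the infinite
    branch of \<open>density_norm\<close>.\<close>
  show ?thesis
    unfolding density_norm_def Let_def \<rho>_def[symmetric] I
    using ac by (simp add: sum_nonneg)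
qed

section \<open>Couplings of empirical measures as doubly stochastic matrices\<close>

text \<open>A value taken by several indices is counted with its multiplicity on the left, and the
  division undoes this. It converts sums over indices into sums over distinct sample points.\<close>

lemma sum_range_div_card_vimage:
  fixes X :: "'n::finite \<Rightarrow> 'a" and h :: "'a \<Rightarrow> real"
  shows "(\<Sum>i\<in>UNIV. h (X i) / real (card (X -` {X i}))) = (\<Sum>x\<in>range X. h x)"
proof -
  have pos: "card (X -` {x}) \<noteq> 0" if "x \<in> range X" for x
    using that by auto
  have "(\<Sum>i\<in>UNIV. h (X i) / real (card (X -` {X i})))
      = (\<Sum>x\<in>range X. real (card {i \<in> UNIV. X i = x}) * (h x / real (card (X -` {x}))))"
    by (rule sum_fun_comp) auto
  also have "\<dots> = (\<Sum>x\<in>range X. h x)"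
    using pos by (intro sum.cong) (auto simp: vimage_def)
  finally show ?thesis .
qed

lemma sets_empirical [simp, measurable_cong]: "sets (empirical X) = sets borel"
  and space_empirical [simp]: "space (empirical X) = UNIV"
  by (simp_all add: empirical_def)

lemma prob_space_empirical: "prob_space (empirical X)"
  by (rule prob_spaceI) (simp add: emeasure_empirical)

lemma measure_empirical_singleton:
  fixes X :: "'n::finite \<Rightarrow> 'a::t1_space"
  shows "measure (empirical X) {x} = real (card (X -` {x})) / real CARD('n)"
proof -
  have "(\<Sum>i\<in>UNIV. indicator {x} (X i)) = real (card (X -` {x}))"
    by (simp add: indicator_def vimage_def)
  then show ?thesis
    by (simp add: measure_def emeasure_empirical)
qed

lemma AE_empirical:
  fixes X :: "'n::finite \<Rightarrow> 'a::t1_space"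
  shows "AE x in empirical X. x \<in> range X"
proof (rule prob_space.AE_prob_1[OF prob_space_empirical])
  have "range X \<in> sets borel"
    by (simp add: borel_closed finite_imp_closed)
  then show "measure (empirical X) (range X) = 1"
    by (simp add: measure_def emeasure_empirical)
qed

locale sample_pair =
  fixes X :: "'n::finite \<Rightarrow> 'a::t1_space" and Y :: "'n \<Rightarrow> 'b::t1_space"
begin

abbreviation "\<mu> \<equiv> empirical X"
abbreviation "\<nu> \<equiv> empirical Y"
abbreviation "S \<equiv> range X \<times> range Y"
abbreviation "nX x \<equiv> real (card (X -` {x}))"
abbreviation "nY y \<equiv> real (card (Y -` {y}))"

definition cost_matrix :: "('a \<Rightarrow> 'b \<Rightarrow> real) \<Rightarrow> real^'n^'n" where
  "cost_matrix f = (\<chi> i j. f (X i) (Y j))"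

text \<open>The density of \<open>\<gamma>\<close> with respect to the product measure is \<open>N\<close> times this matrix: a point
  \<open>x\<close> has mass \<open>nX x / N\<close>.\<close>

definition coupling_matrix :: "('a \<times> 'b) measure \<Rightarrow> real^'n^'n" where
  "coupling_matrix \<gamma> = cost_matrix (\<lambda>x y. real CARD('n) * measure \<gamma> {(x, y)} / (nX x * nY y))"

text \<open>The discrete coupling with mass \<open>\<pi> $ i $ j / N\<close> at the pair
  \<open>(X i, Y j)\<close>. Weights of coinciding pairs add up, so only the block sums of
  \<open>\<pi>\<close> survive.\<close>

definition matrix_coupling :: "real^'n^'n \<Rightarrow> ('a \<times> 'b) measure" where
  "matrix_coupling \<pi> = distr (point_measure UNIV (\<lambda>(i, j). ennreal (\<pi> $ i $ j / real CARD('n))))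
     (borel \<Otimes>\<^sub>M borel) (\<lambda>(i, j). (X i, Y j))"

lemma nX_pos: "x \<in> range X \<Longrightarrow> 0 < nX x" and nY_pos: "y \<in> range Y \<Longrightarrow> 0 < nY y"
  by (auto simp: card_gt_0_iff)

lemma finite_S: "finite S"
  by simp

lemma singleton_sets: "{s} \<in> sets (\<mu> \<Otimes>\<^sub>M \<nu>)"
proof -
  have "{fst s} \<times> {snd s} \<in> sets (\<mu> \<Otimes>\<^sub>M \<nu>)"
    by (intro pair_measureI) auto
  then show ?thesis
    by simp
qed

text \<open>Each marginal is concentrated on its sample points, and this pulls back along the two
  projections.\<close>

lemma coupling_AE:
  assumes "\<gamma> \<in> couplings \<mu> \<nu>"
  shows "AE z in \<gamma>. z \<in> S"
proof -
  have s: "sets \<gamma> = sets (\<mu> \<Otimes>\<^sub>M \<nu>)" and d: "distr \<gamma> \<mu> fst = \<mu>" "distr \<gamma> \<nu> snd = \<nu>"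
    using assms by (auto simp: couplings_def)
  have "fst \<in> measurable \<gamma> \<mu>" "snd \<in> measurable \<gamma> \<nu>"
    unfolding measurable_cong_sets[OF s refl] by auto
  then have "AE z in \<gamma>. fst z \<in> range X" "AE z in \<gamma>. snd z \<in> range Y"
    using d AE_empirical[of X] AE_empirical[of Y]
      AE_distrD[of fst \<gamma> \<mu> "\<lambda>x. x \<in> range X"] AE_distrD[of snd \<gamma> \<nu> "\<lambda>y. y \<in> range Y"]
    by metis+
  then show ?thesis
    by eventually_elim (auto simp: mem_Times_iff)
qed

section \<open>Cost and density norm of a coupling in terms of its matrix\<close>

lemma inner_coupling_matrix:
  "cost_matrix f \<bullet> coupling_matrix \<gamma> = real CARD('n) * (\<Sum>s\<in>S. f (fst s) (snd s) * measure \<gamma> {s})"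
proof -
  have "cost_matrix f \<bullet> coupling_matrix \<gamma>
      = (\<Sum>i\<in>UNIV. (\<Sum>j\<in>UNIV. (real CARD('n) * (f (X i) (Y j) * measure \<gamma> {(X i, Y j)})) / nY (Y j)) / nX (X i))"
    unfolding coupling_matrix_def cost_matrix_def inner_frobenius
    by (simp add: sum_divide_distrib mult_ac)
  also have "\<dots> = (\<Sum>x\<in>range X. \<Sum>y\<in>range Y. real CARD('n) * (f x y * measure \<gamma> {(x, y)}))"
    by (subst sum_range_div_card_vimage, subst sum_range_div_card_vimage) (rule refl)
  also have "\<dots> = real CARD('n) * (\<Sum>s\<in>S. f (fst s) (snd s) * measure \<gamma> {s})"
    by (simp add: sum.cartesian_product sum_distrib_left split_beta)
  finally show ?thesis .
qed

interpretation pair_prob_space \<mu> \<nu>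
  by (intro pair_prob_space.intro pair_sigma_finite.intro prob_space_imp_sigma_finite
      prob_space_empirical)

lemma AE_product: "AE z in \<mu> \<Otimes>\<^sub>M \<nu>. z \<in> S"
proof (rule AE_pair_measure)
  have "S \<in> sets (\<mu> \<Otimes>\<^sub>M \<nu>)"
    by (intro pair_measureI) (simp_all add: borel_closed finite_imp_closed)
  then show "{z \<in> space (\<mu> \<Otimes>\<^sub>M \<nu>). z \<in> S} \<in> sets (\<mu> \<Otimes>\<^sub>M \<nu>)"
    by (simp add: space_pair_measure)
  show "AE x in \<mu>. AE y in \<nu>. (x, y) \<in> S"
    using AE_empirical[of X] by eventually_elim (use AE_empirical[of Y] in auto)
qed

lemma measure_product_singleton:
  "measure (\<mu> \<Otimes>\<^sub>M \<nu>) {s} = nX (fst s) * nY (snd s) / (real CARD('n))\<^sup>2"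
proof -
  have "emeasure (\<mu> \<Otimes>\<^sub>M \<nu>) ({fst s} \<times> {snd s}) = emeasure \<mu> {fst s} * emeasure \<nu> {snd s}"
    by (rule M2.emeasure_pair_measure_Times) auto
  then show ?thesis
    using measure_empirical_singleton[of X "fst s"] measure_empirical_singleton[of Y "snd s"]
    by (simp add: measure_def enn2real_mult power2_eq_square)
qed

lemma cint_eq_sum:
  assumes "prob_space \<gamma>" "sets \<gamma> = sets (\<mu> \<Otimes>\<^sub>M \<nu>)" "AE z in \<gamma>. z \<in> S"
  shows "cint \<gamma> f = (\<Sum>s\<in>S. f (fst s) (snd s) * measure \<gamma> {s})"
  unfolding cint_def split_beta
  using integral_completion_finite_support[OF prob_space.finite_measure[OF assms(1)] finite_S _ assms(3)]
    singleton_sets assms(2) by simp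

lemma cint_coupling:
  assumes "\<gamma> \<in> couplings \<mu> \<nu>"
  shows "cint \<gamma> f = (cost_matrix f \<bullet> coupling_matrix \<gamma>) / real CARD('n)"
  using cint_eq_sum[OF _ _ coupling_AE[OF assms]] assms
  by (simp add: inner_coupling_matrix couplings_def)

lemma cint_product: "cint (\<mu> \<Otimes>\<^sub>M \<nu>) f = (\<Sum>i\<in>UNIV. \<Sum>j\<in>UNIV. f (X i) (Y j)) / (real CARD('n))\<^sup>2"
proof -
  have "cint (\<mu> \<Otimes>\<^sub>M \<nu>) f = (\<Sum>x\<in>range X. \<Sum>y\<in>range Y. nX x * (nY y * f x y)) / (real CARD('n))\<^sup>2"
    by (simp add: cint_eq_sum[OF P.prob_space_axioms _ AE_product] measure_product_singleton
        sum.cartesian_product split_beta sum_divide_distrib mult_ac)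
  also have "\<dots> = (\<Sum>i\<in>UNIV. \<Sum>j\<in>UNIV. f (X i) (Y j)) / (real CARD('n))\<^sup>2"
    using sum_fun_comp[of UNIV "range X" X "\<lambda>x. \<Sum>y\<in>range Y. nY y * f x y"]
      sum_fun_comp[of UNIV "range Y" Y "\<lambda>y. f (X i) y" for i]
    by (simp add: vimage_def sum_distrib_left[symmetric])
  finally show ?thesis .
qed

lemma density_norm_coupling:
  assumes "\<gamma> \<in> couplings \<mu> \<nu>"
  shows "density_norm \<mu> \<nu> \<gamma> = ereal (norm (coupling_matrix \<gamma>))"
proof -
  \<comment> \<open>\<open>inner_coupling_matrix\<close> is used with the entries of the matrix
    themselves as cost. The factor \<open>N\<close> in the density cancels against the masses of the
    product measure, leaving exactly the Frobenius norm.\<close>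
  have "(\<Sum>s\<in>S. (measure \<gamma> {s})\<^sup>2 / measure (\<mu> \<Otimes>\<^sub>M \<nu>) {s}) = coupling_matrix \<gamma> \<bullet> coupling_matrix \<gamma>"
    unfolding inner_coupling_matrix[of "\<lambda>x y. real CARD('n) * measure \<gamma> {(x, y)} / (nX x * nY y)" \<gamma>,
      folded coupling_matrix_def]
    by (simp add: sum_distrib_left measure_product_singleton power2_eq_square mult_ac)
  moreover have "0 < measure (\<mu> \<Otimes>\<^sub>M \<nu>) {s}" if "s \<in> S" for s
    using that nX_pos nY_pos by (auto simp: measure_product_singleton)
  ultimately show ?thesis
    using density_norm_finite_support[OF P.prob_space_axioms _ _ finite_S singleton_sets AE_product
        coupling_AE[OF assms]] assms
    by (simp add: couplings_def norm_eq_sqrt_inner)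
qed

text \<open>Row \<open>i\<close> sums to \<open>N / nX (X i)\<close> times the mass over the point
  \<open>X i\<close>, which the first marginal fixes as \<open>nX (X i) / N\<close>. Columns use the
  second marginal.\<close>

lemma coupling_matrix_doubly_stochastic:
  assumes "\<gamma> \<in> couplings \<mu> \<nu>"
  shows "coupling_matrix \<gamma> \<in> doubly_stochastic"
proof -
  have \<gamma>: "prob_space \<gamma>" "sets \<gamma> = sets (\<mu> \<Otimes>\<^sub>M \<nu>)" "distr \<gamma> \<mu> fst = \<mu>" "distr \<gamma> \<nu> snd = \<nu>"
    using assms by (auto simp: couplings_def)
  interpret prob_space \<gamma> by fact
  have m: "fst \<in> measurable \<gamma> \<mu>" "snd \<in> measurable \<gamma> \<nu>"
    unfolding measurable_cong_sets[OF \<gamma>(2) refl] by auto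
  have sp: "space \<gamma> = UNIV"
    using sets_eq_imp_space_eq[OF \<gamma>(2)] by (simp add: space_pair_measure)
  have meas: "{s} \<in> sets \<gamma>" for s
    using singleton_sets \<gamma>(2) by simp
  have "(\<Sum>y\<in>range Y. measure \<gamma> {(x, y)}) = nX x / real CARD('n)" for x
  proof -
    have "(\<Sum>y\<in>range Y. measure \<gamma> {(x, y)}) = measure \<gamma> (\<Union>y\<in>range Y. {(x, y)})"
      using meas by (intro finite_measure_finite_Union[symmetric]) (auto simp: disjoint_family_on_def)
    also have "\<dots> = measure \<gamma> (fst -` {x} \<inter> space \<gamma>)"
    proof (rule finite_measure_eq_AE)
      \<comment> \<open>The fibre over \<open>x\<close> may contain points whose second coordinate
        is no sample point; these form a null set.\<close>
      show "AE z in \<gamma>. z \<in> (\<Union>y\<in>range Y. {(x, y)}) \<longleftrightarrow> z \<in> fst -` {x} \<inter> space \<gamma>"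
        using coupling_AE[OF assms] by eventually_elim (auto simp: sp)
    qed (use meas measurable_sets[OF m(1), of "{x}"] in auto)
    also have "\<dots> = measure \<mu> {x}"
      using measure_distr[OF m(1), of "{x}"] by (simp add: \<gamma>(3))
    finally show ?thesis
      by (simp add: measure_empirical_singleton)
  qed
  moreover have "(\<Sum>x\<in>range X. measure \<gamma> {(x, y)}) = nY y / real CARD('n)" for y
  proof -
    have "(\<Sum>x\<in>range X. measure \<gamma> {(x, y)}) = measure \<gamma> (\<Union>x\<in>range X. {(x, y)})"
      using meas by (intro finite_measure_finite_Union[symmetric]) (auto simp: disjoint_family_on_def)
    also have "\<dots> = measure \<gamma> (snd -` {y} \<inter> space \<gamma>)"
    proof (rule finite_measure_eq_AE)
      show "AE z in \<gamma>. z \<in> (\<Union>x\<in>range X. {(x, y)}) \<longleftrightarrow> z \<in> snd -` {y} \<inter> space \<gamma>"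
        using coupling_AE[OF assms] by eventually_elim (auto simp: sp)
    qed (use meas measurable_sets[OF m(2), of "{y}"] in auto)
    also have "\<dots> = measure \<nu> {y}"
      using measure_distr[OF m(2), of "{y}"] by (simp add: \<gamma>(4))
    finally show ?thesis
      by (simp add: measure_empirical_singleton)
  qed
  moreover have "(\<Sum>j\<in>UNIV. coupling_matrix \<gamma> $ i $ j)
      = real CARD('n) / nX (X i) * (\<Sum>y\<in>range Y. measure \<gamma> {(X i, y)})" for i
    unfolding sum_range_div_card_vimage[symmetric] coupling_matrix_def cost_matrix_def
    by (simp add: sum_distrib_left)
  moreover have "(\<Sum>i\<in>UNIV. coupling_matrix \<gamma> $ i $ j)
      = real CARD('n) / nY (Y j) * (\<Sum>x\<in>range X. measure \<gamma> {(x, Y j)})" for j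
    unfolding sum_range_div_card_vimage[symmetric] coupling_matrix_def cost_matrix_def
    by (simp add: sum_distrib_left mult.commute)
  moreover have "0 \<le> coupling_matrix \<gamma> $ i $ j" for i j
    by (simp add: coupling_matrix_def cost_matrix_def)
  moreover have "nX (X i) \<noteq> 0" "nY (Y i) \<noteq> 0" for i
    using nX_pos[of "X i"] nY_pos[of "Y i"] by auto
  ultimately show ?thesis
    unfolding doubly_stochastic_iff by simp
qed

text \<open>The multiplicities are positive, so the entries determine all atoms on \<open>S\<close>,
  and a coupling charges nothing else.\<close>

lemma coupling_matrix_inj: "inj_on coupling_matrix (couplings \<mu> \<nu>)"
proof (rule inj_onI)
  fix \<gamma> \<gamma>'
  assume \<gamma>: "\<gamma> \<in> couplings \<mu> \<nu>" and \<gamma>': "\<gamma>' \<in> couplings \<mu> \<nu>"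
    and eq: "coupling_matrix \<gamma> = coupling_matrix \<gamma>'"
  have sets: "sets \<gamma> = sets (\<mu> \<Otimes>\<^sub>M \<nu>)" "sets \<gamma>' = sets (\<mu> \<Otimes>\<^sub>M \<nu>)"
    and prob: "prob_space \<gamma>" "prob_space \<gamma>'"
    using \<gamma> \<gamma>' by (auto simp: couplings_def)
  have "measure \<gamma> {s} = measure \<gamma>' {s}" if sS: "s \<in> S" for s
  proof -
    obtain i j where s: "s = (X i, Y j)"
      using sS by auto
    have "coupling_matrix \<gamma> $ i $ j = coupling_matrix \<gamma>' $ i $ j"
      using eq by simp
    then show ?thesis
      by (auto simp: coupling_matrix_def cost_matrix_def s)
  qed
  then have "emeasure \<gamma> {s} = emeasure \<gamma>' {s}" if "s \<in> S" for s
    using that prob by (simp add: finite_measure.emeasure_eq_measure prob_space.finite_measure)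
  then have "emeasure \<gamma> A = emeasure \<gamma>' A" if "A \<in> sets \<gamma>" for A
    using that sets singleton_sets
      emeasure_finite_support[OF finite_S _ coupling_AE[OF \<gamma>], of A]
      emeasure_finite_support[OF finite_S _ coupling_AE[OF \<gamma>'], of A] by simp
  then show "\<gamma> = \<gamma>'"
    using sets by (intro measure_eqI) auto
qed

section \<open>From doubly stochastic matrices back to couplings\<close>

lemma emeasure_matrix_coupling:
  assumes "\<pi> \<in> doubly_stochastic" and "A \<in> sets (borel \<Otimes>\<^sub>M borel)"
  shows "emeasure (matrix_coupling \<pi>) A
    = ennreal (\<Sum>i\<in>UNIV. \<Sum>j\<in>UNIV. \<pi> $ i $ j / real CARD('n) * indicator A (X i, Y j))"
proof -
  let ?f = "\<lambda>(i, j). (X i, Y j)"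
  have nn: "0 \<le> \<pi> $ i $ j" for i j
    using assms(1) by (simp add: doubly_stochastic_iff)
  have "emeasure (matrix_coupling \<pi>) A = (\<Sum>(i, j)\<in>?f -` A. ennreal (\<pi> $ i $ j / real CARD('n)))"
    unfolding matrix_coupling_def
    by (subst emeasure_distr[OF _ assms(2)])
      (auto simp: space_point_measure space_pair_measure emeasure_point_measure_finite)
  also have "\<dots> = ennreal (\<Sum>(i, j)\<in>?f -` A. \<pi> $ i $ j / real CARD('n))"
    using nn by (simp add: split_beta sum_ennreal)
  also have "(\<Sum>(i, j)\<in>?f -` A. \<pi> $ i $ j / real CARD('n))
      = (\<Sum>(i, j)\<in>UNIV. \<pi> $ i $ j / real CARD('n) * indicator A (X i, Y j))"
    by (rule sum.mono_neutral_cong_left) auto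
  also have "\<dots> = (\<Sum>i\<in>UNIV. \<Sum>j\<in>UNIV. \<pi> $ i $ j / real CARD('n) * indicator A (X i, Y j))"
    by (simp add: sum.cartesian_product)
  finally show ?thesis .
qed

lemma matrix_coupling_in_couplings:
  assumes "\<pi> \<in> doubly_stochastic"
  shows "matrix_coupling \<pi> \<in> couplings \<mu> \<nu>"
proof -
  have row: "(\<Sum>j\<in>UNIV. \<pi> $ i $ j) = 1" and col: "(\<Sum>k\<in>UNIV. \<pi> $ k $ i) = 1" for i
    using assms by (auto simp: doubly_stochastic_iff)
  have sets: "sets (matrix_coupling \<pi>) = sets (borel \<Otimes>\<^sub>M borel)"
    by (simp add: matrix_coupling_def)
  have sp: "space (matrix_coupling \<pi>) = UNIV"
    by (simp add: matrix_coupling_def space_pair_measure)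
  have m: "fst \<in> measurable (matrix_coupling \<pi>) \<mu>" "snd \<in> measurable (matrix_coupling \<pi>) \<nu>"
    unfolding measurable_cong_sets[OF sets sets_empirical] by auto
  have fst: "emeasure (distr (matrix_coupling \<pi>) \<mu> fst) A = emeasure \<mu> A" if "A \<in> sets borel" for A
  proof -
    have "emeasure (distr (matrix_coupling \<pi>) \<mu> fst) A = emeasure (matrix_coupling \<pi>) (A \<times> UNIV)"
      using that by (simp add: emeasure_distr[OF m(1)] sp vimage_fst)
    also have "\<dots> = ennreal (\<Sum>i\<in>UNIV. \<Sum>j\<in>UNIV. \<pi> $ i $ j * (indicator A (X i) / real CARD('n)))"
      using that by (subst emeasure_matrix_coupling[OF assms]) (auto simp: indicator_times)
    also have "\<dots> = ennreal (\<Sum>i\<in>UNIV. (\<Sum>j\<in>UNIV. \<pi> $ i $ j) * (indicator A (X i) / real CARD('n)))"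
      by (simp only: sum_distrib_right)
    finally show ?thesis
      using that by (simp add: row emeasure_empirical sum_divide_distrib)
  qed
  have snd: "emeasure (distr (matrix_coupling \<pi>) \<nu> snd) A = emeasure \<nu> A" if "A \<in> sets borel" for A
  proof -
    have "emeasure (distr (matrix_coupling \<pi>) \<nu> snd) A = emeasure (matrix_coupling \<pi>) (UNIV \<times> A)"
      using that by (simp add: emeasure_distr[OF m(2)] sp vimage_snd)
    also have "\<dots> = ennreal (\<Sum>i\<in>UNIV. \<Sum>j\<in>UNIV. \<pi> $ i $ j * (indicator A (Y j) / real CARD('n)))"
      using that by (subst emeasure_matrix_coupling[OF assms]) (auto simp: indicator_times)
    also have "\<dots> = ennreal (\<Sum>j\<in>UNIV. (\<Sum>i\<in>UNIV. \<pi> $ i $ j) * (indicator A (Y j) / real CARD('n)))"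
      by (subst sum.swap) (simp only: sum_distrib_right)
    finally show ?thesis
      using that by (simp add: col emeasure_empirical sum_divide_distrib)
  qed
  have "distr (matrix_coupling \<pi>) \<mu> fst = \<mu>" "distr (matrix_coupling \<pi>) \<nu> snd = \<nu>"
    using fst snd by (auto intro!: measure_eqI)
  \<comment> \<open>Total mass one is inherited from the first marginal.\<close>
  moreover have "prob_space (matrix_coupling \<pi>)"
    using calculation(1) prob_space_empirical prob_space_distrD[OF m(1)] by metis
  moreover have "sets (matrix_coupling \<pi>) = sets (\<mu> \<Otimes>\<^sub>M \<nu>)"
    unfolding sets by (intro sets_pair_measure_cong) auto
  ultimately show ?thesis
    by (simp add: couplings_def)
qed

text \<open>Passing to the coupling and back averages \<open>\<pi>\<close> over the blocks of
  coinciding points, and \<open>cost_matrix f\<close> is constant on these blocks.\<close>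

lemma inner_coupling_matrix_matrix_coupling:
  assumes "\<pi> \<in> doubly_stochastic"
  shows "cost_matrix f \<bullet> coupling_matrix (matrix_coupling \<pi>) = cost_matrix f \<bullet> \<pi>"
proof -
  have m: "measure (matrix_coupling \<pi>) {s}
      = (\<Sum>i\<in>UNIV. \<Sum>j\<in>UNIV. \<pi> $ i $ j / real CARD('n) * indicator {s} (X i, Y j))" for s
  proof -
    have "0 \<le> \<pi> $ i $ j" for i j
      using assms by (simp add: doubly_stochastic_iff)
    moreover have "{s} \<in> sets (borel \<Otimes>\<^sub>M borel)"
      using singleton_sets[of s] by (simp add: sets_pair_measure_cong[OF sets_empirical sets_empirical])
    ultimately show ?thesis
      by (simp add: measure_def emeasure_matrix_coupling[OF assms] sum_nonneg)
  qed
  have "cost_matrix f \<bullet> coupling_matrix (matrix_coupling \<pi>)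
      = (\<Sum>s\<in>S. \<Sum>i\<in>UNIV. \<Sum>j\<in>UNIV. f (fst s) (snd s) * \<pi> $ i $ j * indicator {s} (X i, Y j))"
    unfolding inner_coupling_matrix m
    by (simp add: sum_distrib_left mult.assoc del: sum_mult_indicator)
  also have "\<dots> = (\<Sum>i\<in>UNIV. \<Sum>j\<in>UNIV. \<Sum>s\<in>S. f (fst s) (snd s) * \<pi> $ i $ j * indicator {s} (X i, Y j))"
    by (subst sum.swap, rule sum.cong[OF refl], rule sum.swap)
  also have "\<dots> = cost_matrix f \<bullet> \<pi>"
    by (simp add: indicator_def if_distrib[of "\<lambda>x. _ * x"] cost_matrix_def inner_frobenius cong: if_cong)
  finally show ?thesis .
qed

lemma norm_coupling_matrix_matrix_coupling_le:
  assumes "\<pi> \<in> doubly_stochastic"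
  shows "norm (coupling_matrix (matrix_coupling \<pi>)) \<le> norm \<pi>"
proof -
  let ?\<sigma> = "coupling_matrix (matrix_coupling \<pi>)"
  \<comment> \<open>Averaging preserves every block-constant cost, in particular the average itself.\<close>
  have "?\<sigma> \<bullet> ?\<sigma> = ?\<sigma> \<bullet> \<pi>"
    by (subst (1 3) coupling_matrix_def) (rule inner_coupling_matrix_matrix_coupling[OF assms])
  then have "norm ?\<sigma> * norm ?\<sigma> \<le> norm ?\<sigma> * norm \<pi>"
    using norm_cauchy_schwarz[of ?\<sigma> \<pi>] by (simp add: power2_norm_eq_inner[symmetric] power2_eq_square)
  then show ?thesis
    by (cases "norm ?\<sigma> = 0") (auto simp: mult_le_cancel_left)
qed

end

section \<open>Constant matrices and the projection of the origin\<close>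

lemma inner_ones_doubly_stochastic:
  fixes \<pi> :: "real^'n^'n"
  assumes "\<pi> \<in> doubly_stochastic"
  shows "(\<chi> i j. k) \<bullet> \<pi> = k * real CARD('n)"
  using assms by (simp add: inner_frobenius doubly_stochastic_iff sum_distrib_left[symmetric])

lemma uniform_doubly_stochastic: "(\<chi> i j. 1 / real CARD('n)) \<in> (doubly_stochastic :: (real^'n^'n) set)"
  by (simp add: doubly_stochastic_iff)

lemmas compact_doubly_stochastic = polytope_imp_compact[OF polytope_doubly_stochastic]
lemmas convex_doubly_stochastic = polytope_imp_convex[OF polytope_doubly_stochastic]
lemmas closed_doubly_stochastic = compact_imp_closed[OF compact_doubly_stochastic]

lemma doubly_stochastic_nonempty: "doubly_stochastic \<noteq> {}"
  using uniform_doubly_stochastic by blast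

text \<open>Constant matrices have the same inner product with every doubly stochastic matrix, so
  the variational inequality holds with equality. Thus excluding the uniform matrix from the optimal
  face means that the origin does not project into it.\<close>

lemma closest_point_doubly_stochastic_0:
  "closest_point doubly_stochastic 0 = (\<chi> i j. 1 / real CARD('n) :: real^'n^'n)"
  unfolding closest_point_eq_iff[OF convex_doubly_stochastic closed_doubly_stochastic
      uniform_doubly_stochastic]
  by (simp add: inner_diff_right inner_ones_doubly_stochastic uniform_doubly_stochastic)

section \<open>Optimal couplings as projections\<close>

context sample_pair
begin

text \<open>The objectives agree up to the factor \<open>1 / N\<close>. A competing matrix
  \<open>\<pi>\<close> need not be the matrix of a coupling, but
  \<open>matrix_coupling \<pi>\<close> has the same cost.\<close>

lemma mem_ot_minimizers_iff:
  "\<gamma> \<in> ot_minimizers f \<mu> \<nu> \<longleftrightarrow> \<gamma> \<in> couplings \<mu> \<nu>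
    \<and> coupling_matrix \<gamma> \<in> minimizers (\<lambda>\<pi>. cost_matrix f \<bullet> \<pi>) doubly_stochastic"
  (is "_ \<longleftrightarrow> _ \<and> ?M")
proof (intro iffI conjI)
  assume \<gamma>: "\<gamma> \<in> ot_minimizers f \<mu> \<nu>"
  then show c: "\<gamma> \<in> couplings \<mu> \<nu>"
    by (simp add: ot_minimizers_def minimizers_iff)
  have "cost_matrix f \<bullet> coupling_matrix \<gamma> \<le> cost_matrix f \<bullet> \<pi>" if "\<pi> \<in> doubly_stochastic" for \<pi>
  proof -
    have "cint \<gamma> f \<le> cint (matrix_coupling \<pi>) f"
      using \<gamma> matrix_coupling_in_couplings[OF that] by (simp add: ot_minimizers_def minimizers_iff)
    then show ?thesis
      by (simp add: cint_coupling c matrix_coupling_in_couplings that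
          inner_coupling_matrix_matrix_coupling divide_le_cancel)
  qed
  then show ?M
    by (simp add: minimizers_iff c coupling_matrix_doubly_stochastic)
next
  assume "\<gamma> \<in> couplings \<mu> \<nu> \<and> ?M"
  then show "\<gamma> \<in> ot_minimizers f \<mu> \<nu>"
    by (auto simp: ot_minimizers_def minimizers_iff cint_coupling coupling_matrix_doubly_stochastic
        intro!: divide_right_mono)
qed

lemma ot_min_norm_eq:
  assumes p: "p = closest_point (minimizers (\<lambda>\<pi>. cost_matrix f \<bullet> \<pi>) doubly_stochastic) 0"
  shows "ot_min_norm f \<mu> \<nu> = matrix_coupling p" and "coupling_matrix (matrix_coupling p) = p"
proof -
  let ?M = "minimizers (\<lambda>\<pi>. cost_matrix f \<bullet> \<pi>) doubly_stochastic"
  note M = minimizers_inner[OF compact_doubly_stochastic convex_doubly_stochastic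
      doubly_stochastic_nonempty, of "cost_matrix f"]
  have pM: "p \<in> ?M"
    unfolding p by (rule closest_point_in_set[OF M(2,3)])
  then have pD: "p \<in> doubly_stochastic"
    by (simp add: minimizers_iff)
  have less: "norm p < norm \<pi>" if "\<pi> \<in> ?M" "\<pi> \<noteq> p" for \<pi>
    using closest_point_0_less[OF M(1,2)] that unfolding p by blast
  have "coupling_matrix (matrix_coupling p) \<in> ?M"
    using pM by (simp add: minimizers_iff inner_coupling_matrix_matrix_coupling
        matrix_coupling_in_couplings coupling_matrix_doubly_stochastic)
  \<comment> \<open>Block averaging keeps \<open>p\<close> in the optimal face without increasing
    its norm; since \<open>p\<close> is the strict minimizer, it equals its own average.\<close>
  then show eq: "coupling_matrix (matrix_coupling p) = p"
    using less norm_coupling_matrix_matrix_coupling_le[OF pD] by fastforce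
  show "ot_min_norm f \<mu> \<nu> = matrix_coupling p"
    unfolding ot_min_norm_def
  proof (rule the_minimizer_eqI)
    show "matrix_coupling p \<in> ot_minimizers f \<mu> \<nu>"
      unfolding mem_ot_minimizers_iff eq using pM matrix_coupling_in_couplings[OF pD] by blast
    fix \<gamma>
    assume \<gamma>: "\<gamma> \<in> ot_minimizers f \<mu> \<nu>" "\<gamma> \<noteq> matrix_coupling p"
    then have "coupling_matrix \<gamma> \<noteq> p"
      using inj_onD[OF coupling_matrix_inj, of \<gamma> "matrix_coupling p"] eq
        matrix_coupling_in_couplings[OF pD] by (auto simp: mem_ot_minimizers_iff)
    then show "density_norm \<mu> \<nu> (matrix_coupling p) < density_norm \<mu> \<nu> \<gamma>"
      using less[of "coupling_matrix \<gamma>"] \<gamma>(1) matrix_coupling_in_couplings[OF pD]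
      by (simp add: density_norm_coupling mem_ot_minimizers_iff eq)
  qed
qed

lemma qot_optimal_eq:
  assumes "0 < \<eta>"
    and p: "p = closest_point doubly_stochastic (- (\<eta> / (2 * real CARD('n))) *\<^sub>R cost_matrix f)"
  shows "qot_optimal f \<mu> \<nu> \<eta> = matrix_coupling p" and "coupling_matrix (matrix_coupling p) = p"
proof -
  let ?s = "\<eta> / (2 * real CARD('n))"
  \<comment> \<open>This is \<open>\<eta>\<close> times the regularized objective: the cost of a
    coupling carries a factor \<open>1 / N\<close>, hence
    \<open>2 * ?s = \<eta> / N\<close>.\<close>
  let ?q = "\<lambda>\<pi>. 2 * ?s * (cost_matrix f \<bullet> \<pi>) + (norm \<pi>)\<^sup>2"
  have pD: "p \<in> doubly_stochastic"
    unfolding p by (rule closest_point_in_set[OF closed_doubly_stochastic doubly_stochastic_nonempty])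
  have less: "?q p < ?q \<pi>" if "\<pi> \<in> doubly_stochastic" "\<pi> \<noteq> p" for \<pi>
    using closest_point_quadratic_less[OF convex_doubly_stochastic closed_doubly_stochastic] that
    unfolding p by blast
  have "?q (coupling_matrix (matrix_coupling p)) \<le> ?q p"
    using norm_coupling_matrix_matrix_coupling_le[OF pD]
    by (simp add: inner_coupling_matrix_matrix_coupling[OF pD] power_mono)
  then show eq: "coupling_matrix (matrix_coupling p) = p"
    using less coupling_matrix_doubly_stochastic[OF matrix_coupling_in_couplings[OF pD]] by fastforce
  have val: "ereal (cint \<gamma> f) + ereal (1 / \<eta>) * (density_norm \<mu> \<nu> \<gamma>)\<^sup>2
      = ereal (?q (coupling_matrix \<gamma>) / \<eta>)" if "\<gamma> \<in> couplings \<mu> \<nu>" for \<gamma>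
    using \<open>0 < \<eta>\<close> by (simp add: cint_coupling density_norm_coupling that add_divide_distrib)
  show "qot_optimal f \<mu> \<nu> \<eta> = matrix_coupling p"
    unfolding qot_optimal_def
  proof (rule the_minimizer_eqI)
    show m: "matrix_coupling p \<in> couplings \<mu> \<nu>"
      by (rule matrix_coupling_in_couplings[OF pD])
    fix \<gamma>
    assume \<gamma>: "\<gamma> \<in> couplings \<mu> \<nu>" "\<gamma> \<noteq> matrix_coupling p"
    \<comment> \<open>Injectivity turns the strict minimality of \<open>p\<close> among matrices
      into uniqueness among couplings.\<close>
    then have "coupling_matrix \<gamma> \<noteq> p"
      using inj_onD[OF coupling_matrix_inj, of \<gamma> "matrix_coupling p"] eq m by auto
    then have "?q p / \<eta> < ?q (coupling_matrix \<gamma>) / \<eta>"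
      using less coupling_matrix_doubly_stochastic[OF \<gamma>(1)] \<open>0 < \<eta>\<close>
      by (intro divide_strict_right_mono) auto
    then show "ereal (cint (matrix_coupling p) f)
        + ereal (1 / \<eta>) * (density_norm \<mu> \<nu> (matrix_coupling p))\<^sup>2
      < ereal (cint \<gamma> f) + ereal (1 / \<eta>) * (density_norm \<mu> \<nu> \<gamma>)\<^sup>2"
      unfolding val[OF m] val[OF \<gamma>(1)] eq less_ereal.simps(1) .
  qed
qed

lemma norm_centred_cost:
  fixes f :: "'a \<Rightarrow> 'b \<Rightarrow> real"
  defines "m \<equiv> cint (\<mu> \<Otimes>\<^sub>M \<nu>) f"
  shows "(norm (cost_matrix f - (\<chi> i j. m)))\<^sup>2
    = (real CARD('n))\<^sup>2 * (cint (\<mu> \<Otimes>\<^sub>M \<nu>) (\<lambda>x y. (f x y)\<^sup>2) - m\<^sup>2)"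
proof -
  let ?N = "real CARD('n)"
  have m: "(\<Sum>i\<in>UNIV. \<Sum>j\<in>UNIV. f (X i) (Y j)) = ?N\<^sup>2 * m"
    unfolding m_def cint_product by simp
  have "(norm (cost_matrix f - (\<chi> i j. m)))\<^sup>2
      = (\<Sum>i\<in>UNIV. \<Sum>j\<in>UNIV. (f (X i) (Y j))\<^sup>2 - 2 * m * f (X i) (Y j) + m\<^sup>2)"
    unfolding power2_norm_eq_inner inner_frobenius cost_matrix_def
    by (simp add: power2_eq_square algebra_simps)
  also have "\<dots> = (\<Sum>i\<in>UNIV. \<Sum>j\<in>UNIV. (f (X i) (Y j))\<^sup>2)
      - 2 * m * (\<Sum>i\<in>UNIV. \<Sum>j\<in>UNIV. f (X i) (Y j)) + ?N\<^sup>2 * m\<^sup>2"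
    by (simp add: sum.distrib sum_subtractf sum_distrib_left power2_eq_square)
  also have "\<dots> = ?N\<^sup>2 * (cint (\<mu> \<Otimes>\<^sub>M \<nu>) (\<lambda>x y. (f x y)\<^sup>2) - m\<^sup>2)"
    unfolding m cint_product by (simp add: algebra_simps power2_eq_square)
  finally show ?thesis .
qed

end

section \<open>Threshold and slope for the regularized couplings\<close>

theorem proposition3p1:
  fixes X Y :: "'n::finite \<Rightarrow> real^'d" and c :: "real^'d \<Rightarrow> real^'d \<Rightarrow> real"
    and \<mu> \<nu> :: "(real^'d) measure"
    and C \<pi>s :: "real^'n^'n" and M :: "(real^'n^'n) set"
    and \<gamma> :: "real \<Rightarrow> ((real^'d) \<times> (real^'d)) measure" and \<gamma>s :: "((real^'d) \<times> (real^'d)) measure"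
    and N \<eta>s :: real
  assumes "N = real CARD('n)"
    and "\<mu> = empirical X" and "\<nu> = empirical Y"
    and "C = (\<chi> i j. c (X i) (Y j))"
    and "M = minimizers (\<lambda>\<pi>. C \<bullet> \<pi>) doubly_stochastic"
    and "\<pi>s = the_minimizer (\<lambda>\<pi>. (norm \<pi>)\<^sup>2) M"
    and "(\<chi> i j. 1 / N) \<notin> M"
    and "\<gamma> = qot_optimal c \<mu> \<nu>" and "\<gamma>s = ot_min_norm c \<mu> \<nu>"
    and "\<eta>s = 2 * N * (MAX \<pi>\<in>{\<pi>. \<pi> extreme_point_of doubly_stochastic} - M.
                         (\<pi>s \<bullet> (\<pi>s - \<pi>)) / (C \<bullet> (\<pi> - \<pi>s)))"
  shows "(\<forall>\<eta>>0. (\<gamma> \<eta> \<in> ot_minimizers c \<mu> \<nu> \<longleftrightarrow> \<eta> \<ge> \<eta>s) \<and> (\<eta> \<ge> \<eta>s \<longrightarrow> \<gamma> \<eta> = \<gamma>s)) \<and>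
    Limsup (at \<eta>s) (\<lambda>\<eta>. ereal ((cint (\<gamma> \<eta>) c - cint \<gamma>s c) / (\<eta>s - \<eta>)))
      \<le> ereal (1 / 2 * (cint (\<mu> \<Otimes>\<^sub>M \<nu>) (\<lambda>x y. (c x y)\<^sup>2) - (cint (\<mu> \<Otimes>\<^sub>M \<nu>) c)\<^sup>2))"
proof -
  interpret sample_pair X Y .
  let ?D = "doubly_stochastic :: (real^'n^'n) set"
  let ?V = "cint (\<mu> \<Otimes>\<^sub>M \<nu>) (\<lambda>x y. (c x y)\<^sup>2) - (cint (\<mu> \<Otimes>\<^sub>M \<nu>) c)\<^sup>2"
  have C: "C = cost_matrix c"
    by (simp add: assms(4) cost_matrix_def)
  have N: "0 < N"
    by (simp add: assms(1))
  define p where "p = (\<lambda>\<eta>. closest_point ?D (- (\<eta> / (2 * N)) *\<^sub>R C))"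
  define t where "t = (MAX \<pi>\<in>{\<pi>. \<pi> extreme_point_of ?D} - M.
                         (\<pi>s \<bullet> (\<pi>s - \<pi>)) / (C \<bullet> (\<pi> - \<pi>s)))"
  have \<eta>s: "\<eta>s = 2 * N * t"
    using assms(10) by (simp add: t_def)
  note M = minimizers_inner[OF compact_doubly_stochastic convex_doubly_stochastic
      doubly_stochastic_nonempty, of C, folded assms(5)]
  have \<pi>s: "\<pi>s = closest_point M 0"
    unfolding assms(6)
    by (rule the_minimizer_eqI)
      (auto intro: closest_point_in_set[OF M(2,3)] power_strict_mono closest_point_0_less[OF M(1,2)])
  have "closest_point ?D 0 \<notin> M"
    using assms(1,7) by (simp add: closest_point_doubly_stochastic_0)
  note threshold = polytope_doubly_stochastic doubly_stochastic_nonempty assms(5) \<pi>s t_def this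
  \<comment> \<open>Hence parameters near \<open>\<eta>s\<close>, and all those above it, are
    positive, where \<open>qot_optimal_eq\<close> describes \<open>\<gamma> \<eta>\<close>.\<close>
  have "0 < \<eta>s"
    using threshold_pos[OF threshold] N by (simp add: \<eta>s)
  have t_le: "t \<le> \<eta> / (2 * N) \<longleftrightarrow> \<eta>s \<le> \<eta>" for \<eta>
    using N by (simp add: \<eta>s field_simps)
  have face: "p \<eta> \<in> M \<longleftrightarrow> \<eta>s \<le> \<eta>" for \<eta>
    unfolding p_def closest_point_in_face_iff[OF threshold] by (rule t_le)
  have p_eq: "p \<eta> = \<pi>s" if "\<eta>s \<le> \<eta>" for \<eta>
    unfolding p_def using closest_point_in_face_eq[OF threshold] that t_le by blast
  have \<gamma>: "\<gamma> \<eta> = matrix_coupling (p \<eta>)" "coupling_matrix (\<gamma> \<eta>) = p \<eta>" if "0 < \<eta>" for \<eta>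
    using qot_optimal_eq[OF that, of "p \<eta>" c] unfolding p_def assms(1,2,3,8) C by auto
  have \<gamma>s: "\<gamma>s = matrix_coupling \<pi>s"
    using ot_min_norm_eq(1)[of \<pi>s c] \<pi>s unfolding assms(2,3,5,9) C by auto
  have pD: "p \<eta> \<in> ?D" for \<eta>
    unfolding p_def by (rule closest_point_in_set[OF closed_doubly_stochastic doubly_stochastic_nonempty])
  have coupling: "\<gamma> \<eta> \<in> couplings \<mu> \<nu>" if "0 < \<eta>" for \<eta>
    using matrix_coupling_in_couplings[OF pD] \<gamma>(1)[OF that] assms(2,3) by simp
  have a1: "\<gamma> \<eta> \<in> ot_minimizers c \<mu> \<nu> \<longleftrightarrow> \<eta>s \<le> \<eta>" if "0 < \<eta>" for \<eta>
    using mem_ot_minimizers_iff[of "\<gamma> \<eta>" c] coupling[OF that] \<gamma>(2)[OF that] face[of \<eta>]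
    by (simp add: assms(2,3,5) C)
  have a2: "\<gamma> \<eta> = \<gamma>s" if "\<eta>s \<le> \<eta>" for \<eta>
    using \<gamma>(1)[of \<eta>] \<gamma>s p_eq[OF that] that \<open>0 < \<eta>s\<close> by simp
  have cint: "cint (\<gamma> \<eta>) c = (C \<bullet> p \<eta>) / N" if "0 < \<eta>" for \<eta>
    using cint_coupling[of "\<gamma> \<eta>" c] coupling[OF that] \<gamma>(2)[OF that] assms(1,2,3) C by simp
  \<comment> \<open>The subtracted constant matrix vanishes on differences of doubly stochastic
    matrices, so \<open>?b\<close> may replace \<open>C\<close> in the slope bound.\<close>
  let ?b = "C - (\<chi> i j. cint (\<mu> \<Otimes>\<^sub>M \<nu>) c)"
  have nb: "(norm ?b)\<^sup>2 = N\<^sup>2 * ?V"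
    unfolding C assms(1,2,3) by (rule norm_centred_cost)
  have "0 \<le> N\<^sup>2 * ?V"
    unfolding nb[symmetric] by (rule zero_le_power2)
  \<comment> \<open>Nonnegativity covers the side \<open>\<eta> > \<eta>s\<close>, where the
    difference quotient is zero.\<close>
  then have V: "0 \<le> ?V"
    using N by (simp only: zero_le_mult_iff) auto
  have slope: "(cint (\<gamma> \<eta>) c - cint \<gamma>s c) / (\<eta>s - \<eta>) \<le> 1 / 2 * ?V" if "0 < \<eta>" "\<eta> \<noteq> \<eta>s" for \<eta>
  proof (cases "\<eta>s \<le> \<eta>")
    case True
    then show ?thesis
      using V a2 by simp
  next
    case False
    \<comment> \<open>The slope lemma between the parameters \<open>\<eta> / (2 * N)\<close> and
      \<open>\<eta>s / (2 * N)\<close>. The factor \<open>N\<^sup>2\<close> in \<open>nb\<close>,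
      the \<open>2 * N\<close> here and the \<open>1 / N\<close> in the cost combine to
      \<open>1 / 2\<close>.\<close>
    have "C \<bullet> (p \<eta> - p \<eta>s) \<le> (\<eta>s / (2 * N) - \<eta> / (2 * N)) * (norm ?b)\<^sup>2"
      unfolding p_def
      using False N
      by (intro closest_point_slope_le convex_doubly_stochastic closed_doubly_stochastic
          doubly_stochastic_nonempty)
        (auto simp: inner_diff_left inner_diff_right inner_ones_doubly_stochastic divide_right_mono)
    also have "\<dots> = N * ((\<eta>s - \<eta>) * (1 / 2 * ?V))"
      unfolding nb using N by (simp add: field_simps power2_eq_square)
    finally have "(C \<bullet> p \<eta> - C \<bullet> p \<eta>s) / N \<le> (\<eta>s - \<eta>) * (1 / 2 * ?V)"
      using N by (simp add: inner_diff_right pos_divide_le_eq mult.commute)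
    moreover have "cint (\<gamma> \<eta>) c - cint \<gamma>s c = (C \<bullet> p \<eta> - C \<bullet> p \<eta>s) / N"
      using cint[OF that(1)] cint[OF \<open>0 < \<eta>s\<close>] a2[of \<eta>s] by (simp add: diff_divide_distrib)
    ultimately have "cint (\<gamma> \<eta>) c - cint \<gamma>s c \<le> (1 / 2 * ?V) * (\<eta>s - \<eta>)"
      by (simp only: mult.commute)
    then show ?thesis
      using False by (subst pos_divide_le_eq) auto
  qed
  \<comment> \<open>The bound is available only for positive \<open>\<eta>\<close> other than
    \<open>\<eta>s\<close>; near \<open>\<eta>s\<close> this suffices for the limes
    superior.\<close>
  have "eventually (\<lambda>\<eta>. 0 < \<eta> \<and> \<eta> \<noteq> \<eta>s) (at \<eta>s)"
    using \<open>0 < \<eta>s\<close> order_tendstoD(1)[OF tendsto_ident_at, of 0 \<eta>s UNIV]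
    by (auto intro: eventually_conj eventually_neq_at_within)
  then have "Limsup (at \<eta>s) (\<lambda>\<eta>. ereal ((cint (\<gamma> \<eta>) c - cint \<gamma>s c) / (\<eta>s - \<eta>))) \<le> ereal (1 / 2 * ?V)"
    by (intro Limsup_bounded, elim eventually_mono) (use slope in \<open>unfold ereal_less_eq, blast\<close>)
  then show ?thesis
    using a1 a2 by blast
qed

end
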